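(* Let $0<p<\infty$. Let $\mathcal{X}\in\mathbb{R}^{I_1\times I_2\times I_3}$ be a tensor with multi-linear rank $(r_1,r_2,r_3)$ and let $\mathcal{G}\in\mathbb{R}^{d_1\times d_2\times d_3}$ satisfy $\mathcal{X}=\mathcal{G}\times_1 U\times_2 V\times_3 W$, where $U\in\mathbb{R}^{I_1\times d_1}$, $V\in\mathbb{R}^{I_2\times d_2}$, $W\in\mathbb{R}^{I_3\times d_3}$ satisfy $U^TU=I_{d_1}$, $V^TV=I_{d_2}$ and $W^TW=I_{d_3}$. Then $\|\mathcal{X}\|_{\mathcal{S}_p}=\|\mathcal{G}\|_{\mathcal{S}_p}$.
   Context: For a third-order real tensor $\mathcal{X}\in\mathbb{R}^{I_1\times I_2\times I_3}$, the mode-$n$ unfolding $\mathcal{X}_{(n)}\in\mathbb{R}^{I_n\times\prod_{j\ne n}I_j}$ maps the entry $(i_1,i_2,i_3)$ to the matrix entry $(i_n,j)$ with $j=1+\sum_{k\ne n}(i_k-1)J_k$, $J_k=\prod_{m<k,\,m\neq n}I_m$. The multi-linear rank of $\mathcal{X}$ is the tuple $(\mathrm{rank}(\mathcal{X}_{(1)}),\mathrm{rank}(\mathcal{X}_{(2)}),\mathrm{rank}(\mathcal{X}_{(3)}))$. The $1$-mode product of $\mathcal{X}$ with $U\in\mathbb{R}^{J\times I_1}$ is $(\mathcal{X}\times_1U)_{j i_2 i_3}=\sum_{i_1}x_{i_1i_2i_3}u_{ji_1}$, and $\times_2,\times_3$ are defined analogously. For a matrix $M$ with singular values $\sigma_i$,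 $\|M\|_{\mathcal{S}_p}=(\sum_i\sigma_i^p)^{1/p}$. The Schatten $p$-norm ($0<p<\infty$) of a third-order tensor is the average over its unfoldings: $\|\mathcal{X}\|_{\mathcal{S}_p}=\frac13\sum_{n=1}^3\|\mathcal{X}_{(n)}\|_{\mathcal{S}_p}$. $I_d$ with $d=d_n$ as a matrix denotes the $d\times d$ identity. *)

theory Defs
  imports
    Complex_Main
    "HOL-Library.FuncSet"
    "Jordan_Normal_Form.DL_Rank"
    "Jordan_Normal_Form.Char_Poly"
begin

text \<open>
  Third-order tensors are represented like the matrices of \<open>Jordan_Normal_Form.Matrix\<close>: the three
  dimensions together with an entry function on 0-based indices that is normalised outside the
  index range, so that equality of tensors is equality of dimensions and of entries in range.
\<close>

definition mk_tensor3 ::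
  "nat \<Rightarrow> nat \<Rightarrow> nat \<Rightarrow> (nat \<times> nat \<times> nat \<Rightarrow> 'a) \<Rightarrow> (nat \<times> nat \<times> nat \<Rightarrow> 'a)" where
  "mk_tensor3 n1 n2 n3 f = restrict f ({..<n1} \<times> {..<n2} \<times> {..<n3})"

typedef 'a tensor3 =
  "{(n1, n2, n3, mk_tensor3 n1 n2 n3 f) | n1 n2 n3 f :: nat \<times> nat \<times> nat \<Rightarrow> 'a. True}"
  by blast

setup_lifting type_definition_tensor3

lift_definition dim1 :: "'a tensor3 \<Rightarrow> nat" is fst .
lift_definition dim2 :: "'a tensor3 \<Rightarrow> nat" is "fst \<circ> snd" .
lift_definition dim3 :: "'a tensor3 \<Rightarrow> nat" is "fst \<circ> snd \<circ> snd" .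
lift_definition entry :: "'a tensor3 \<Rightarrow> nat \<times> nat \<times> nat \<Rightarrow> 'a" is "snd \<circ> snd \<circ> snd" .
lift_definition tensor3 ::
  "nat \<Rightarrow> nat \<Rightarrow> nat \<Rightarrow> (nat \<times> nat \<times> nat \<Rightarrow> 'a) \<Rightarrow> 'a tensor3"
  is "\<lambda>n1 n2 n3 f. (n1, n2, n3, mk_tensor3 n1 n2 n3 f)" by auto

definition carrier_tensor3 :: "nat \<Rightarrow> nat \<Rightarrow> nat \<Rightarrow> 'a tensor3 set" where
  "carrier_tensor3 n1 n2 n3 = {X. dim1 X = n1 \<and> dim2 X = n2 \<and> dim3 X = n3}"

lemma dim_tensor3 [simp]:
  "dim1 (tensor3 n1 n2 n3 f) = n1"
  "dim2 (tensor3 n1 n2 n3 f) = n2"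
  "dim3 (tensor3 n1 n2 n3 f) = n3"
  by (transfer, simp)+

lemma entry_tensor3 [simp]:
  "i1 < n1 \<Longrightarrow> i2 < n2 \<Longrightarrow> i3 < n3 \<Longrightarrow> entry (tensor3 n1 n2 n3 f) (i1, i2, i3) = f (i1, i2, i3)"
  by transfer (simp add: mk_tensor3_def)

lemma eq_tensor3I:
  assumes "dim1 X = dim1 Y" "dim2 X = dim2 Y" "dim3 X = dim3 Y"
    and "\<And>i1 i2 i3. i1 < dim1 Y \<Longrightarrow> i2 < dim2 Y \<Longrightarrow> i3 < dim3 Y \<Longrightarrow>
      entry X (i1, i2, i3) = entry Y (i1, i2, i3)"
  shows "X = Y"
  using assms by transfer (auto simp: mk_tensor3_def intro!: restrict_ext)

definition mode1_prod :: "'a::comm_semiring_0 tensor3 \<Rightarrow> 'a mat \<Rightarrow> 'a tensor3"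
    (infixl "\<times>\<^sub>1" 70) where
  "X \<times>\<^sub>1 U = tensor3 (dim_row U) (dim2 X) (dim3 X)
     (\<lambda>(j, i2, i3). \<Sum>i1<dim1 X. entry X (i1, i2, i3) * U $$ (j, i1))"

definition mode2_prod :: "'a::comm_semiring_0 tensor3 \<Rightarrow> 'a mat \<Rightarrow> 'a tensor3"
    (infixl "\<times>\<^sub>2" 70) where
  "X \<times>\<^sub>2 V = tensor3 (dim1 X) (dim_row V) (dim3 X)
     (\<lambda>(i1, j, i3). \<Sum>i2<dim2 X. entry X (i1, i2, i3) * V $$ (j, i2))"

definition mode3_prod :: "'a::comm_semiring_0 tensor3 \<Rightarrow> 'a mat \<Rightarrow> 'a tensor3"
    (infixl "\<times>\<^sub>3" 70) where
  "X \<times>\<^sub>3 W = tensor3 (dim1 X) (dim2 X) (dim_row W)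
     (\<lambda>(i1, i2, j). \<Sum>i3<dim3 X. entry X (i1, i2, i3) * W $$ (j, i3))"

text \<open>
  In the mode-\<open>n\<close> unfolding the column of the entry with index \<open>(i1, i2, i3)\<close> enumerates the two
  indices other than the \<open>n\<close>-th, the lower-numbered one varying fastest; \<open>mod\<close> and \<open>div\<close> recover
  the two indices from the column. The lemma \<open>unfold_entry\<close> gives the column in terms of the indices.
\<close>

definition unfold1 :: "'a tensor3 \<Rightarrow> 'a mat" where
  "unfold1 X = mat (dim1 X) (dim2 X * dim3 X)
     (\<lambda>(i, j). entry X (i, j mod dim2 X, j div dim2 X))"

definition unfold2 :: "'a tensor3 \<Rightarrow> 'a mat" where
  "unfold2 X = mat (dim2 X) (dim1 X * dim3 X)
     (\<lambda>(i, j). entry X (j mod dim1 X, i, j div dim1 X))"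

definition unfold3 :: "'a tensor3 \<Rightarrow> 'a mat" where
  "unfold3 X = mat (dim3 X) (dim1 X * dim2 X)
     (\<lambda>(i, j). entry X (j mod dim1 X, j div dim1 X, i))"

lemma unfold_column_less:
  assumes "(a::nat) < m" "b < n"
  shows "a + b * m < m * n"
proof -
  have "a + b * m < Suc b * m" using assms(1) by simp
  also have "\<dots> \<le> n * m" using assms(2) by (intro mult_le_mono1) simp
  finally show ?thesis by (simp add: mult.commute)
qed

lemma unfold_entry:
  assumes "i1 < dim1 X" "i2 < dim2 X" "i3 < dim3 X"
  shows "unfold1 X $$ (i1, i2 + i3 * dim2 X) = entry X (i1, i2, i3)"
    and "unfold2 X $$ (i2, i1 + i3 * dim1 X) = entry X (i1, i2, i3)"
    and "unfold3 X $$ (i3, i1 + i2 * dim1 X) = entry X (i1, i2, i3)"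
  using assms by (simp_all add: unfold1_def unfold2_def unfold3_def unfold_column_less)

definition mat_rank :: "'a::field mat \<Rightarrow> nat" where
  "mat_rank A = vec_space.rank (dim_row A) A"

definition multilinear_rank :: "'a::field tensor3 \<Rightarrow> nat \<times> nat \<times> nat" where
  "multilinear_rank X = (mat_rank (unfold1 X), mat_rank (unfold2 X), mat_rank (unfold3 X))"

text \<open>
  The singular values of \<open>M\<close>, with multiplicity, are the square roots of the eigenvalues of
  \<open>M\<^sup>T M\<close>. This matrix is positive semidefinite, so all roots of its characteristic polynomial are
  real and nonnegative. There are \<open>dim_col M\<close> of them; compared with the convention of listing
  \<open>min (dim_row M) (dim_col M)\<close> singular values, any additional ones are zero, and
  these do not contribute to the Schatten norm since \<open>0 powr p = 0\<close>.
\<close>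

definition singular_values :: "real mat \<Rightarrow> real multiset" where
  "singular_values M = image_mset sqrt (proots (char_poly (transpose_mat M * M)))"

definition schatten_norm_mat :: "real \<Rightarrow> real mat \<Rightarrow> real" where
  "schatten_norm_mat p M = (\<Sum>\<sigma>\<in>#singular_values M. \<sigma> powr p) powr (1 / p)"

definition schatten_norm :: "real \<Rightarrow> real tensor3 \<Rightarrow> real" where
  "schatten_norm p X =
     (schatten_norm_mat p (unfold1 X) + schatten_norm_mat p (unfold2 X)
       + schatten_norm_mat p (unfold3 X)) / 3"

end

theory Submission
  imports Defs
begin

text \<open>
  Each unfolding of \<open>X\<close> has the form \<open>P * A * Q\<^sup>T\<close>, where \<open>A\<close> is the corresponding unfolding of \<open>G\<close>
  and \<open>P\<close> and the Kronecker product \<open>Q\<close> have orthonormal columns. Its Gram matrix is therefore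
  \<open>Q * (A\<^sup>T * A) * Q\<^sup>T\<close>. Since \<open>A * B\<close> and \<open>B * A\<close> have the same characteristic polynomial up to a
  power of the indeterminate, its characteristic polynomial agrees up to such a power
  with that of \<open>A\<^sup>T * A\<close>, and additional zero singular values do not change the Schatten norm.
\<close>

section \<open>Characteristic polynomials of \<open>A * B\<close> and \<open>B * A\<close>\<close>

text \<open>One bordered matrix \<open>N\<close> has both characteristic matrices as Schur
  complements, so computing \<open>det N\<close> by two block eliminations relates them. Powers on
  both sides keep the identity free of division and of any ordering of \<open>m\<close> and
  \<open>n\<close>.\<close>

lemma char_poly_mult_swap:
  fixes A B :: "'a::idom mat"
  assumes A: "A \<in> carrier_mat m n" and B: "B \<in> carrier_mat n m"
  shows "[:0, 1:] ^ n * char_poly (A * B) = [:0, 1:] ^ m * char_poly (B * A)"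
proof -
  let ?c = "map_mat (\<lambda>a::'a. [:a:])"
  let ?x = "[:0, 1::'a:]"
  interpret c: comm_ring_hom "\<lambda>a::'a. [:a:]"
    by unfold_locales (auto simp: one_pCons)
  have A': "?c A \<in> carrier_mat m n" and B': "?c B \<in> carrier_mat n m"
    using A B by auto
  have char: "char_poly_matrix C = ?x \<cdot>\<^sub>m 1\<^sub>m k - ?c C" if "C \<in> carrier_mat k k" for C k
    using that by (intro eq_matI) (auto simp: char_poly_matrix_def)
  have hom: "?c (A * B) = ?c A * ?c B" "?c (B * A) = ?c B * ?c A"
    using c.mat_hom_mult[OF A B] c.mat_hom_mult[OF B A] by simp_all
  have AB: "char_poly_matrix (A * B) = ?x \<cdot>\<^sub>m 1\<^sub>m m - ?c A * ?c B"
    using char[of "A * B" m] A B hom by simp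
  have BA: "char_poly_matrix (B * A) = ?x \<cdot>\<^sub>m 1\<^sub>m n - ?c B * ?c A"
    using char[of "B * A" n] A B hom by simp
  \<comment> \<open>Multiplying \<open>N\<close> by \<open>R\<close> on the right clears the lower
    left block and leaves \<open>x - A * B\<close> in the upper left; multiplying by
    \<open>L\<close> on the left clears the same block and leaves \<open>x - B * A\<close> in the
    lower right. The block \<open>x\<close> in \<open>L\<close> avoids dividing by the
    indeterminate, at the price of \<open>det L = x ^ n\<close>.\<close>
  define N where "N = four_block_mat (?x \<cdot>\<^sub>m 1\<^sub>m m) (?c A) (?c B) (1\<^sub>m n)"
  define R where "R = four_block_mat (1\<^sub>m m) (0\<^sub>m m n) (- ?c B) (1\<^sub>m n)"
  define L where "L = four_block_mat (1\<^sub>m m) (0\<^sub>m m n) (- ?c B) (?x \<cdot>\<^sub>m 1\<^sub>m n)"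
  have carr: "N \<in> carrier_mat (m + n) (m + n)" "R \<in> carrier_mat (m + n) (m + n)"
    "L \<in> carrier_mat (m + n) (m + n)"
    unfolding N_def R_def L_def using A' B' by auto
  have "det R = 1"
    unfolding R_def using B' by (subst det_four_block_mat_upper_right_zero) auto
  have "det L = ?x ^ n"
    unfolding L_def using B'
    by (subst det_four_block_mat_upper_right_zero) (auto simp: det_smult)
  have NR: "N * R = four_block_mat (char_poly_matrix (A * B)) (?c A) (0\<^sub>m n m) (1\<^sub>m n)"
    unfolding N_def R_def AB using A' B'
    by (subst mult_four_block_mat[of _ m m _ n _ n _ _ m _ n])
      (auto intro!: cong_four_block_mat)
  have LN: "L * N = four_block_mat (?x \<cdot>\<^sub>m 1\<^sub>m m) (?c A) (0\<^sub>m n m) (char_poly_matrix (B * A))"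
    unfolding N_def L_def BA using A' B'
    by (subst mult_four_block_mat[of _ m m _ n _ n _ _ m _ n])
      (auto intro!: cong_four_block_mat)
  have "det N = char_poly (A * B)"
  proof -
    have "det N = det (N * R)" using carr \<open>det R = 1\<close> by (simp add: det_mult)
    also have "\<dots> = char_poly (A * B)"
      unfolding NR using A A' B
      by (subst det_four_block_mat_lower_left_zero) (auto simp: char_poly_def)
    finally show ?thesis .
  qed
  moreover have "?x ^ n * det N = ?x ^ m * char_poly (B * A)"
  proof -
    have "?x ^ n * det N = det (L * N)" using carr \<open>det L = ?x ^ n\<close> by (simp add: det_mult)
    also have "\<dots> = ?x ^ m * char_poly (B * A)"
      unfolding LN using A A' B
      by (subst det_four_block_mat_lower_left_zero) (auto simp: char_poly_def det_smult)
    finally show ?thesis .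
  qed
  ultimately show ?thesis by simp
qed

text \<open>The powers of the indeterminate only add copies of the root 0, on which \<open>g\<close>
  vanishes.\<close>

lemma sum_proots_char_poly_mult_swap:
  fixes A B :: "'a::idom mat" and g :: "'a \<Rightarrow> 'b::cancel_comm_monoid_add"
  assumes A: "A \<in> carrier_mat m n" and B: "B \<in> carrier_mat n m" and g: "g 0 = 0"
  shows "(\<Sum>x\<in>#proots (char_poly (A * B)). g x) = (\<Sum>x\<in>#proots (char_poly (B * A)). g x)"
proof -
  have *: "(\<Sum>x\<in>#proots ([:0, 1:] ^ k * q). g x) = (\<Sum>x\<in>#proots q. g x)"
    if "q \<noteq> 0" for k and q :: "'a poly"
  proof -
    have "(\<Sum>x\<in>#replicate_mset k 0. g x) = 0"
      by (induction k) (simp_all add: g)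
    then have "(\<Sum>x\<in>#proots ([:0, 1:] ^ k). g x) = 0"
      by (simp add: proots_power g)
    then show ?thesis using that by (simp add: proots_mult)
  qed
  have "A * B \<in> carrier_mat m m" "B * A \<in> carrier_mat n n"
    by (rule mult_carrier_mat[OF A B], rule mult_carrier_mat[OF B A])
  \<comment> \<open>Root multisets add under multiplication only for nonzero polynomials; these are
    monic.\<close>
  then have "char_poly (A * B) \<noteq> 0" "char_poly (B * A) \<noteq> 0"
    by (auto dest!: degree_monic_char_poly)
  then have "(\<Sum>x\<in>#proots ([:0, 1:] ^ n * char_poly (A * B)). g x) =
      (\<Sum>x\<in>#proots (char_poly (A * B)). g x)"
    "(\<Sum>x\<in>#proots ([:0, 1:] ^ m * char_poly (B * A)). g x) =
      (\<Sum>x\<in>#proots (char_poly (B * A)). g x)"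
    by (simp_all only: * not_False_eq_True)
  then show ?thesis unfolding char_poly_mult_swap[OF A B] by (rule trans[OF sym])
qed

section \<open>Invariance of the matrix norm under orthonormal factors\<close>

text \<open>In the Gram matrix the factor \<open>P\<close> cancels at once. The outer
  \<open>Q\<close> is removed by moving it cyclically to the right, which changes the size of the
  matrix but not its nonzero spectrum.\<close>

lemma schatten_norm_mat_orthonormal:
  assumes P: "P \<in> carrier_mat m' m" and A: "A \<in> carrier_mat m n" and Q: "Q \<in> carrier_mat n' n"
    and PP: "transpose_mat P * P = 1\<^sub>m m" and QQ: "transpose_mat Q * Q = 1\<^sub>m n"
  shows "schatten_norm_mat p (P * A * transpose_mat Q) = schatten_norm_mat p A"
proof -
  let ?M = "P * A * transpose_mat Q" and ?At = "transpose_mat A" and ?Qt = "transpose_mat Q"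
  have carr: "transpose_mat P \<in> carrier_mat m m'" "?At \<in> carrier_mat n m" "?Qt \<in> carrier_mat n n'"
    "P * A \<in> carrier_mat m' n" "?At * A \<in> carrier_mat n n" "A * ?Qt \<in> carrier_mat m n'"
    "?At * (A * ?Qt) \<in> carrier_mat n n'"
    using P A Q by auto
  have "?M = P * (A * ?Qt)" using P A carr by simp
  moreover have "transpose_mat ?M = Q * ?At * transpose_mat P"
    using transpose_mult[OF carr(4,3)] transpose_mult[OF P A] Q carr by simp
  ultimately have "transpose_mat ?M * ?M = Q * ?At * transpose_mat P * (P * (A * ?Qt))"
    by argo
  also have "\<dots> = Q * ?At * (transpose_mat P * P * (A * ?Qt))"
    using assoc_mult_mat[OF mult_carrier_mat[OF Q carr(2)] carr(1) mult_carrier_mat[OF P carr(6)]]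
      assoc_mult_mat[OF carr(1) P carr(6)] by simp
  also have "\<dots> = Q * (?At * (A * ?Qt))"
    unfolding PP using assoc_mult_mat[OF Q carr(2,6)] carr by simp
  finally have gram: "transpose_mat ?M * ?M = Q * (?At * (A * ?Qt))" .
  have "?At * (A * ?Qt) * Q = ?At * A * (?Qt * Q)"
    using assoc_mult_mat[OF carr(2) carr(6) Q] assoc_mult_mat[OF A carr(3) Q]
      assoc_mult_mat[OF carr(2) A mult_carrier_mat[OF carr(3) Q]] by simp
  also have "\<dots> = ?At * A" unfolding QQ using carr by simp
  finally have "?At * (A * ?Qt) * Q = ?At * A" .
  \<comment> \<open>The summand vanishes at 0 because \<open>sqrt 0 = 0\<close> and
    \<open>0 powr p = 0\<close>, as the swap lemma demands.\<close>
  then show ?thesis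
    using sum_proots_char_poly_mult_swap[OF Q carr(7), of "\<lambda>x. sqrt x powr p"]
    by (simp add: schatten_norm_mat_def singular_values_def gram multiset.map_comp comp_def)
qed

section \<open>Kronecker products\<close>

text \<open>The index of the second factor varies fastest. This matches the column order of the
  unfoldings when the matrix of the higher mode is put first.\<close>

definition mat_kron :: "'a::times mat \<Rightarrow> 'a mat \<Rightarrow> 'a mat" where
  "mat_kron A B = mat (dim_row A * dim_row B) (dim_col A * dim_col B)
     (\<lambda>(i, j). A $$ (i div dim_row B, j div dim_col B) * B $$ (i mod dim_row B, j mod dim_col B))"

lemma mat_kron_carrier:
  "A \<in> carrier_mat m n \<Longrightarrow> B \<in> carrier_mat m' n' \<Longrightarrow> mat_kron A B \<in> carrier_mat (m * m') (n * n')"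
  by (auto simp: mat_kron_def)

lemma div_mod_less:
  assumes "(k::nat) < n * m"
  shows "k div m < n" "k mod m < m"
  using assms by (auto simp: less_mult_imp_div_less intro!: mod_less_divisor gr0I)

text \<open>Splits a sum over a flat column index into a sum over the two indices it encodes, by
  cutting the range into \<open>n\<close> blocks of length \<open>m\<close>.\<close>

lemma sum_div_mod:
  fixes f :: "nat \<Rightarrow> nat \<Rightarrow> 'a::comm_monoid_add"
  shows "(\<Sum>k<n * m. f (k div m) (k mod m)) = (\<Sum>b<n. \<Sum>a<m. f b a)"
proof -
  have "(\<Sum>k<n * m. f (k div m) (k mod m)) =
      (\<Sum>b<n. \<Sum>k\<in>{b * m..<b * m + m}. f (k div m) (k mod m))"
    by (rule sum.nat_group[symmetric])
  also have "\<dots> = (\<Sum>b<n. \<Sum>a<m. f b a)"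
  proof (rule sum.cong[OF refl])
    fix b
    show "(\<Sum>k\<in>{b * m..<b * m + m}. f (k div m) (k mod m)) = (\<Sum>a<m. f b a)"
      using sum.shift_bounds_nat_ivl[of "\<lambda>k. f (k div m) (k mod m)" 0 "b * m" m]
      by (simp add: atLeast0LessThan add.commute)
  qed
  finally show ?thesis .
qed

text \<open>Each Gram entry factors into a Gram entry of \<open>A\<close> and one of
  \<open>B\<close>, and an index is determined by its quotient and remainder.\<close>

lemma mat_kron_orthonormal:
  fixes A B :: "'a::comm_ring_1 mat"
  assumes A: "A \<in> carrier_mat m n" and B: "B \<in> carrier_mat m' n'"
    and AA: "transpose_mat A * A = 1\<^sub>m n" and BB: "transpose_mat B * B = 1\<^sub>m n'"
  shows "transpose_mat (mat_kron A B) * mat_kron A B = 1\<^sub>m (n * n')"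
proof (rule eq_matI)
  fix i j assume "i < dim_row (1\<^sub>m (n * n') :: 'a mat)" "j < dim_col (1\<^sub>m (n * n') :: 'a mat)"
  then have ij: "i < n * n'" "j < n * n'" by auto
  note dm = div_mod_less[OF ij(1)] div_mod_less[OF ij(2)]
  have gramA: "(\<Sum>k<m. A $$ (k, a) * A $$ (k, b)) = (if a = b then 1 else 0)"
    if "a < n" "b < n" for a b
    using arg_cong[OF AA, of "\<lambda>M. M $$ (a, b)"] that A
    by (simp add: scalar_prod_def atLeast0LessThan)
  have gramB: "(\<Sum>k<m'. B $$ (k, a) * B $$ (k, b)) = (if a = b then 1 else 0)"
    if "a < n'" "b < n'" for a b
    using arg_cong[OF BB, of "\<lambda>M. M $$ (a, b)"] that B
    by (simp add: scalar_prod_def atLeast0LessThan)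
  have "(transpose_mat (mat_kron A B) * mat_kron A B) $$ (i, j) =
      (\<Sum>k<m * m'. (A $$ (k div m', i div n') * B $$ (k mod m', i mod n')) *
        (A $$ (k div m', j div n') * B $$ (k mod m', j mod n')))"
    using ij A B by (simp add: scalar_prod_def mat_kron_def atLeast0LessThan)
  also have "\<dots> = (\<Sum>b<m. \<Sum>a<m'. (A $$ (b, i div n') * B $$ (a, i mod n')) *
        (A $$ (b, j div n') * B $$ (a, j mod n')))"
    by (rule sum_div_mod)
  also have "\<dots> = (\<Sum>b<m. A $$ (b, i div n') * A $$ (b, j div n')) *
      (\<Sum>a<m'. B $$ (a, i mod n') * B $$ (a, j mod n'))"
    by (simp add: sum_product mult_ac)
  also have "\<dots> = (if i div n' = j div n' \<and> i mod n' = j mod n' then 1 else 0)"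
    using dm by (simp add: gramA gramB)
  also have "i div n' = j div n' \<and> i mod n' = j mod n' \<longleftrightarrow> i = j"
    by (metis div_mult_mod_eq)
  finally show "(transpose_mat (mat_kron A B) * mat_kron A B) $$ (i, j) = 1\<^sub>m (n * n') $$ (i, j)"
    using ij by simp
qed (use A B in \<open>auto simp: mat_kron_def\<close>)

section \<open>Unfoldings of a multiplied core tensor\<close>

context
  fixes G :: "'a::comm_semiring_0 tensor3" and U V W :: "'a mat" and I1 I2 I3 d1 d2 d3 :: nat
  assumes G: "G \<in> carrier_tensor3 d1 d2 d3"
    and U: "U \<in> carrier_mat I1 d1" and V: "V \<in> carrier_mat I2 d2" and W: "W \<in> carrier_mat I3 d3"
begin

text \<open>The mode-3 product is applied last, so its sum is outermost; the unfolding lemmas bring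
  their sums into this order.\<close>

lemma entry_tucker:
  assumes "i1 < I1" "i2 < I2" "i3 < I3"
  shows "entry (G \<times>\<^sub>1 U \<times>\<^sub>2 V \<times>\<^sub>3 W) (i1, i2, i3) =
    (\<Sum>c<d3. \<Sum>b<d2. \<Sum>a<d1. entry G (a, b, c) * U $$ (i1, a) * V $$ (i2, b) * W $$ (i3, c))"
  using assms G U V W
  by (simp add: mode1_prod_def mode2_prod_def mode3_prod_def carrier_tensor3_def sum_distrib_right)

lemma dim_tucker:
  "dim1 (G \<times>\<^sub>1 U \<times>\<^sub>2 V \<times>\<^sub>3 W) = I1"
  "dim2 (G \<times>\<^sub>1 U \<times>\<^sub>2 V \<times>\<^sub>3 W) = I2"
  "dim3 (G \<times>\<^sub>1 U \<times>\<^sub>2 V \<times>\<^sub>3 W) = I3"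
  using U V W by (auto simp: mode1_prod_def mode2_prod_def mode3_prod_def)

lemma unfold1_tucker:
  "unfold1 (G \<times>\<^sub>1 U \<times>\<^sub>2 V \<times>\<^sub>3 W) = U * unfold1 G * transpose_mat (mat_kron W V)"
proof (rule eq_matI)
  fix i j assume "i < dim_row (U * unfold1 G * transpose_mat (mat_kron W V))"
    "j < dim_col (U * unfold1 G * transpose_mat (mat_kron W V))"
  then have ij: "i < I1" "j < I3 * I2" using U V W by (auto simp: mat_kron_def)
  have "(U * unfold1 G * transpose_mat (mat_kron W V)) $$ (i, j) =
      (\<Sum>k<d3 * d2. (\<Sum>a<d1. U $$ (i, a) * entry G (a, k mod d2, k div d2)) *
        (W $$ (j div I2, k div d2) * V $$ (j mod I2, k mod d2)))"
    \<comment> \<open>The unfolding has \<open>d2 * d3\<close> columns and the Kronecker product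
      \<open>d3 * d2\<close>; commuting the factors gives both the same index range.\<close>
    using ij G U V W
    by (simp add: scalar_prod_def atLeast0LessThan unfold1_def mat_kron_def carrier_tensor3_def
        mult.commute[of d2 d3])
  also have "\<dots> = (\<Sum>c<d3. \<Sum>b<d2. (\<Sum>a<d1. U $$ (i, a) * entry G (a, b, c)) *
        (W $$ (j div I2, c) * V $$ (j mod I2, b)))"
    by (rule sum_div_mod)
  also have "\<dots> = entry (G \<times>\<^sub>1 U \<times>\<^sub>2 V \<times>\<^sub>3 W) (i, j mod I2, j div I2)"
    using ij by (simp add: entry_tucker div_mod_less sum_distrib_left mult_ac)
  finally show "unfold1 (G \<times>\<^sub>1 U \<times>\<^sub>2 V \<times>\<^sub>3 W) $$ (i, j) =
      (U * unfold1 G * transpose_mat (mat_kron W V)) $$ (i, j)"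
    using ij by (simp add: unfold1_def dim_tucker mult.commute)
qed (use U V W in \<open>auto simp: unfold1_def dim_tucker mat_kron_def mult.commute\<close>)

lemma unfold2_tucker:
  "unfold2 (G \<times>\<^sub>1 U \<times>\<^sub>2 V \<times>\<^sub>3 W) = V * unfold2 G * transpose_mat (mat_kron W U)"
proof (rule eq_matI)
  fix i j assume "i < dim_row (V * unfold2 G * transpose_mat (mat_kron W U))"
    "j < dim_col (V * unfold2 G * transpose_mat (mat_kron W U))"
  then have ij: "i < I2" "j < I3 * I1" using U V W by (auto simp: mat_kron_def)
  have "(V * unfold2 G * transpose_mat (mat_kron W U)) $$ (i, j) =
      (\<Sum>k<d3 * d1. (\<Sum>b<d2. V $$ (i, b) * entry G (k mod d1, b, k div d1)) *
        (W $$ (j div I1, k div d1) * U $$ (j mod I1, k mod d1)))"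
    using ij G U V W
    by (simp add: scalar_prod_def atLeast0LessThan unfold2_def mat_kron_def carrier_tensor3_def
        mult.commute[of d1 d3])
  also have "\<dots> = (\<Sum>c<d3. \<Sum>a<d1. (\<Sum>b<d2. V $$ (i, b) * entry G (a, b, c)) *
        (W $$ (j div I1, c) * U $$ (j mod I1, a)))"
    by (rule sum_div_mod)
  \<comment> \<open>The product with \<open>V\<close> puts the sum over \<open>b\<close> innermost;
    it has to change places with the sum over \<open>a\<close>.\<close>
  also have "\<dots> = (\<Sum>c<d3. \<Sum>b<d2. \<Sum>a<d1. V $$ (i, b) * entry G (a, b, c) *
        (W $$ (j div I1, c) * U $$ (j mod I1, a)))"
    unfolding sum_distrib_right by (intro sum.cong refl sum.swap)
  also have "\<dots> = entry (G \<times>\<^sub>1 U \<times>\<^sub>2 V \<times>\<^sub>3 W) (j mod I1, i, j div I1)"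
    using ij by (simp add: entry_tucker div_mod_less mult_ac)
  finally show "unfold2 (G \<times>\<^sub>1 U \<times>\<^sub>2 V \<times>\<^sub>3 W) $$ (i, j) =
      (V * unfold2 G * transpose_mat (mat_kron W U)) $$ (i, j)"
    using ij by (simp add: unfold2_def dim_tucker mult.commute)
qed (use U V W in \<open>auto simp: unfold2_def dim_tucker mat_kron_def mult.commute\<close>)

lemma unfold3_tucker:
  "unfold3 (G \<times>\<^sub>1 U \<times>\<^sub>2 V \<times>\<^sub>3 W) = W * unfold3 G * transpose_mat (mat_kron V U)"
proof (rule eq_matI)
  fix i j assume "i < dim_row (W * unfold3 G * transpose_mat (mat_kron V U))"
    "j < dim_col (W * unfold3 G * transpose_mat (mat_kron V U))"
  then have ij: "i < I3" "j < I2 * I1" using U V W by (auto simp: mat_kron_def)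
  have "(W * unfold3 G * transpose_mat (mat_kron V U)) $$ (i, j) =
      (\<Sum>k<d2 * d1. (\<Sum>c<d3. W $$ (i, c) * entry G (k mod d1, k div d1, c)) *
        (V $$ (j div I1, k div d1) * U $$ (j mod I1, k mod d1)))"
    using ij G U V W
    by (simp add: scalar_prod_def atLeast0LessThan unfold3_def mat_kron_def carrier_tensor3_def
        mult.commute[of d1 d2])
  also have "\<dots> = (\<Sum>b<d2. \<Sum>a<d1. (\<Sum>c<d3. W $$ (i, c) * entry G (a, b, c)) *
        (V $$ (j div I1, b) * U $$ (j mod I1, a)))"
    by (rule sum_div_mod)
  \<comment> \<open>The sum over \<open>c\<close> moves outwards in two exchanges, first past
    \<open>a\<close> and then past \<open>b\<close>.\<close>
  also have "\<dots> = (\<Sum>b<d2. \<Sum>c<d3. \<Sum>a<d1. W $$ (i, c) * entry G (a, b, c) *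
        (V $$ (j div I1, b) * U $$ (j mod I1, a)))"
    unfolding sum_distrib_right by (intro sum.cong refl sum.swap)
  also have "\<dots> = (\<Sum>c<d3. \<Sum>b<d2. \<Sum>a<d1. W $$ (i, c) * entry G (a, b, c) *
        (V $$ (j div I1, b) * U $$ (j mod I1, a)))"
    by (rule sum.swap)
  also have "\<dots> = entry (G \<times>\<^sub>1 U \<times>\<^sub>2 V \<times>\<^sub>3 W) (j mod I1, j div I1, i)"
    using ij by (simp add: entry_tucker div_mod_less mult_ac)
  finally show "unfold3 (G \<times>\<^sub>1 U \<times>\<^sub>2 V \<times>\<^sub>3 W) $$ (i, j) =
      (W * unfold3 G * transpose_mat (mat_kron V U)) $$ (i, j)"
    using ij by (simp add: unfold3_def dim_tucker mult.commute)
qed (use U V W in \<open>auto simp: unfold3_def dim_tucker mat_kron_def mult.commute\<close>)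

end

theorem theorem1:
  fixes p :: real
    and I1 I2 I3 d1 d2 d3 r1 r2 r3 :: nat
    and X G :: "real tensor3"
    and U V W :: "real mat"
  assumes "0 < p"
    and "X \<in> carrier_tensor3 I1 I2 I3"
    and "multilinear_rank X = (r1, r2, r3)"
    and "G \<in> carrier_tensor3 d1 d2 d3"
    and "U \<in> carrier_mat I1 d1"
    and "V \<in> carrier_mat I2 d2"
    and "W \<in> carrier_mat I3 d3"
    and "X = G \<times>\<^sub>1 U \<times>\<^sub>2 V \<times>\<^sub>3 W"
    and "transpose_mat U * U = 1\<^sub>m d1"
    and "transpose_mat V * V = 1\<^sub>m d2"
    and "transpose_mat W * W = 1\<^sub>m d3"
  shows "schatten_norm p X = schatten_norm p G"
proof -
  have carr: "unfold1 G \<in> carrier_mat d1 (d3 * d2)" "unfold2 G \<in> carrier_mat d2 (d3 * d1)"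
    "unfold3 G \<in> carrier_mat d3 (d2 * d1)"
    using assms(4)
    by (auto simp: carrier_tensor3_def unfold1_def unfold2_def unfold3_def mult.commute)
  note tucker = unfold1_tucker unfold2_tucker unfold3_tucker
  note tucker = tucker[OF assms(4-7), folded assms(8)]
  \<comment> \<open>For each mode, \<open>P\<close> is the matrix of that mode and \<open>Q\<close>
    the Kronecker product of the other two, so the three terms of the average agree one by
    one.\<close>
  note norm1 = schatten_norm_mat_orthonormal[OF assms(5) carr(1)
    mat_kron_carrier[OF assms(7,6)] assms(9) mat_kron_orthonormal[OF assms(7,6,11,10)]]
  note norm2 = schatten_norm_mat_orthonormal[OF assms(6) carr(2)
    mat_kron_carrier[OF assms(7,5)] assms(10) mat_kron_orthonormal[OF assms(7,5,11,9)]]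
  note norm3 = schatten_norm_mat_orthonormal[OF assms(7) carr(3)
    mat_kron_carrier[OF assms(6,5)] assms(11) mat_kron_orthonormal[OF assms(6,5,10,9)]]
  show ?thesis
    unfolding schatten_norm_def tucker norm1 norm2 norm3 ..
qed

end
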